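(* Let $x\ge3$ and $t\ge2$ be integers with $(t,x)\ne(2,3)$, and let $v$ be a positive integer with $v\equiv\pm1\pmod{tx}$ and $$v>\frac{t^2x^2+t^2x+tx^2+t+x+1}{tx-t-x-1}.$$ Then every multiset of size $v-1$ with support $\{1,x,tx\}$ is realizable. In particular, this holds (for all $v\equiv\pm1\pmod{tx}$) whenever $t,x\ge7$.
   Context: $K_v$ is the complete graph on vertex set $\{0,\dots,v-1\}$; the length of an edge $\{u,w\}$ is $\min(|u-w|,v-|u-w|)$. A multiset $L$ of size $v-1$ is realizable if some Hamiltonian path in $K_v$ has multiset of edge lengths equal to $L$. The support of a multiset is its set of distinct elements.
   Formalization: The multiset is also required to consist of possible edge lengths of K_v, i.e. integers from 1 to floor(v/2), so tx <= v/2; without this the claim fails, e.g. for t=x=7, v=97, where no edge has length 49. *)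

theory Defs
  imports Complex_Main "HOL-Library.Multiset" "HOL-Number_Theory.Cong"
begin

definition complete_graph_edges :: "nat \<Rightarrow> nat set set" where
  "complete_graph_edges v = {{u, w} |u w. u < v \<and> w < v \<and> u \<noteq> w}"

text \<open>A path is represented by its list of vertices.\<close>

definition hamiltonian_path :: "'a set \<Rightarrow> 'a set set \<Rightarrow> 'a list \<Rightarrow> bool" where
  "hamiltonian_path V E p \<longleftrightarrow>
     distinct p \<and> set p = V \<and> successively (\<lambda>u w. {u, w} \<in> E) p"

definition edge_length :: "nat \<Rightarrow> nat \<Rightarrow> nat \<Rightarrow> nat" where
  "edge_length v u w =
     nat (min \<bar>int u - int w\<bar> (int v - \<bar>int u - int w\<bar>))"

text \<open>\<^term>\<open>zip p (tl p)\<close> lists the pairs of consecutive vertices of the path.\<close>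

definition path_edge_lengths :: "nat \<Rightarrow> nat list \<Rightarrow> nat multiset" where
  "path_edge_lengths v p = mset (map (\<lambda>(u, w). edge_length v u w) (zip p (tl p)))"

definition realizable :: "nat \<Rightarrow> nat multiset \<Rightarrow> bool" where
  "realizable v L \<longleftrightarrow>
     (\<exists>p. hamiltonian_path {0..<v} (complete_graph_edges v) p \<and> path_edge_lengths v p = L)"

text \<open>
  The multisets under consideration consist of possible edge lengths of the complete graph
  on v vertices, that is, of integers between 1 and the floor of v/2.  This has to be
  required: for v = 2tx - 1, for instance, no edge has length tx, so no multiset whose
  support contains tx is realizable.
\<close>

definition edge_length_multiset :: "nat \<Rightarrow> nat multiset \<Rightarrow> bool" where
  "edge_length_multiset v L \<longleftrightarrow> size L = v - 1 \<and> set_mset L \<subseteq> {1..v div 2}"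

end

theory Submission
  imports Defs
begin

text \<open>
  For every x at least 2 and every b there is a Hamiltonian path of the integers 0, ..., x + b
  that starts at 0, uses x steps of length 1 and b steps of length x: snake through the residue
  classes modulo x.  Gluing such a path for x to the reflection of one for y at the common
  end vertex shows that every multiset with a copies of 1, b of x and c of y, where x + y is
  at most a, is realized by absolute differences of integers, without reduction modulo v.

  If v = txk + 1 or v = txk - 1, multiplication by x and by tx modulo v maps the lengths
  1, t, tk to x, tx, 1 and the lengths 1, k, kx to tx, 1, x, respectively.  So it
  suffices that the multiplicity of 1 is at least x + tx, or that of x at least t + tk, or that
  of tx at least k + kx.  The lower bound on v says that the sum v - 1 of the multiplicities
  is at least the sum of these three thresholds.
\<close>

section \<open>Hamiltonian paths with steps 1 and x\<close>

fun path_diffs :: "nat list \<Rightarrow> nat multiset" where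
  "path_diffs (u # w # p) = add_mset (nat \<bar>int u - int w\<bar>) (path_diffs (w # p))"
| "path_diffs _ = {#}"

lemma path_diffs_append_last: "p \<noteq> [] \<Longrightarrow> path_diffs (p @ q) = path_diffs p + path_diffs (last p # q)"
  by (induction p rule: path_diffs.induct) auto

lemma path_diffs_append:
  "p \<noteq> [] \<Longrightarrow> q \<noteq> [] \<Longrightarrow>
   path_diffs (p @ q) = path_diffs p + path_diffs q + {#nat \<bar>int (last p) - int (hd q)\<bar>#}"
  by (subst path_diffs_append_last) (auto simp: neq_Nil_conv)

lemma path_diffs_rev: "path_diffs (rev p) = path_diffs p"
proof (induction p rule: path_diffs.induct)
  case (1 u w p)
  have "path_diffs (rev (u # w # p)) = path_diffs ((rev p @ [w]) @ [u])" by simp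
  also have "\<dots> = path_diffs (rev (w # p)) + path_diffs [w, u]"
    by (subst path_diffs_append_last) auto
  finally show ?case using 1 by (simp add: abs_minus_commute)
qed auto

lemma path_diffs_shift: "path_diffs (map (\<lambda>n. n + s) p) = path_diffs p"
  by (induction p rule: path_diffs.induct) auto

lemma path_diffs_reflect: "set p \<subseteq> {..s} \<Longrightarrow> path_diffs (map (\<lambda>n. s - n) p) = path_diffs p"
  by (induction p rule: path_diffs.induct) (auto simp: of_nat_diff)

lemma size_diffs: "p \<noteq> [] \<Longrightarrow> size (path_diffs p) = length p - 1"
  by (induction p rule: path_diffs.induct) auto

text \<open>Only the number \<open>a\<close> of unit steps is tracked, because joining paths adds
  these up in a controlled way. The number of steps \<open>x\<close> stays existential: a path on
  \<open>S\<close> has \<open>card S - 1\<close> steps in all, so it can be recovered by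
  counting.\<close>

definition has_path :: "nat \<Rightarrow> nat set \<Rightarrow> nat \<Rightarrow> nat \<Rightarrow> nat \<Rightarrow> bool" where
  "has_path x S u w a \<longleftrightarrow>
     (\<exists>p b. distinct p \<and> set p = S \<and> p \<noteq> [] \<and> hd p = u \<and> last p = w \<and>
            path_diffs p = replicate_mset a 1 + replicate_mset b x)"

lemma has_path_single: "has_path x {u} u u 0"
  unfolding has_path_def by (rule exI[of _ "[u]"]) auto

lemma has_path_rev: "has_path x S u w a \<Longrightarrow> has_path x S w u a"
  unfolding has_path_def by (metis path_diffs_rev distinct_rev hd_rev last_rev rev_is_Nil_conv set_rev)

lemma has_path_join_1:
  assumes "has_path x S u w a" "has_path x T u' w' a'" "S \<inter> T = {}" "u' = w + 1 \<or> w = u' + 1"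
  shows "has_path x (S \<union> T) u w' (a + a' + 1)"
proof -
  obtain p b q c where p: "distinct p" "set p = S" "p \<noteq> []" "hd p = u" "last p = w"
      "path_diffs p = replicate_mset a 1 + replicate_mset b x"
    and q: "distinct q" "set q = T" "q \<noteq> []" "hd q = u'" "last q = w'"
      "path_diffs q = replicate_mset a' 1 + replicate_mset c x"
    using assms(1,2) unfolding has_path_def by blast
  have "nat \<bar>int w - int u'\<bar> = 1" using assms(4) by auto
  then have "path_diffs (p @ q) = replicate_mset (a + a' + 1) 1 + replicate_mset (b + c) x"
    by (simp add: path_diffs_append p q multiset_eq_iff)
  then show ?thesis unfolding has_path_def using p q assms(3)
    by (intro exI[of _ "p @ q"] exI[of _ "b + c"]) auto
qed

lemma has_path_join_x:
  assumes "has_path x S u w a" "has_path x T u' w' a'" "S \<inter> T = {}" "u' = w + x \<or> w = u' + x"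
  shows "has_path x (S \<union> T) u w' (a + a')"
proof -
  obtain p b q c where p: "distinct p" "set p = S" "p \<noteq> []" "hd p = u" "last p = w"
      "path_diffs p = replicate_mset a 1 + replicate_mset b x"
    and q: "distinct q" "set q = T" "q \<noteq> []" "hd q = u'" "last q = w'"
      "path_diffs q = replicate_mset a' 1 + replicate_mset c x"
    using assms(1,2) unfolding has_path_def by blast
  have "nat \<bar>int w - int u'\<bar> = x" using assms(4) by auto
  then have "path_diffs (p @ q) = replicate_mset (a + a') 1 + replicate_mset (b + c + 1) x"
    by (simp add: path_diffs_append p q multiset_eq_iff)
  then show ?thesis unfolding has_path_def using p q assms(3)
    by (intro exI[of _ "p @ q"] exI[of _ "b + c + 1"]) auto
qed

section \<open>Residue classes modulo x and snakes through them\<close>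

text \<open>The lower index \<open>l\<close> is there so that a residue class can be visited in two
  separate pieces.\<close>

definition column :: "nat \<Rightarrow> nat \<Rightarrow> nat \<Rightarrow> nat \<Rightarrow> nat set" where
  "column x i l h = (\<lambda>j. i + j * x) ` {l..h}"

lemma column_single: "column x i l l = {i + l * x}"
  by (simp add: column_def)

lemma column_disjoint:
  assumes "i < x" "i' < x" "i \<noteq> i' \<or> h < l' \<or> h' < l"
  shows "column x i l h \<inter> column x i' l' h' = {}"
proof -
  have "i = i' \<and> j = j'" if "i + j * x = i' + j' * x" for j j'
  proof -
    have "(i + j * x) mod x = i" "(i' + j' * x) mod x = i'" using assms(1,2) by auto
    then show ?thesis using that assms(1) by simp
  qed
  then show ?thesis using assms(3) by (fastforce simp: column_def)
qed

lemma has_path_column: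
  assumes "i < x" "l \<le> h"
  shows "has_path x (column x i l h) (i + l * x) (i + h * x) 0"
  using assms(2)
proof (induction h rule: dec_induct)
  case base
  then show ?case by (simp add: column_single has_path_single)
next
  case (step h)
  have "column x i l (Suc h) = column x i l h \<union> {i + Suc h * x}"
    using step.hyps by (auto simp: column_def atLeastAtMostSuc_conv)
  moreover have "column x i l h \<inter> {i + Suc h * x} = {}"
    using column_disjoint[of i x i h "Suc h" "Suc h" l] assms(1) by (simp add: column_single)
  ultimately show ?case
    using has_path_join_x[OF step.IH has_path_single, of "i + Suc h * x"] by simp
qed

text \<open>A union of complete columns, cut off at \<open>N\<close>. Indexing by a set of residues
  makes it additive in \<open>A\<close>, so that covering all residues covers all vertices.\<close>

definition rows :: "nat \<Rightarrow> nat \<Rightarrow> nat set \<Rightarrow> nat set" where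
  "rows x N A = {n. n < N \<and> n mod x \<in> A}"

lemma rows_Un: "rows x N (A \<union> B) = rows x N A \<union> rows x N B"
  by (auto simp: rows_def)

lemma rows_all: "0 < x \<Longrightarrow> rows x N {..<x} = {..<N}"
  by (auto simp: rows_def)

text \<open>The two bounds on \<open>N\<close> make \<open>h\<close> the index of the last element
  of class \<open>i\<close> below \<open>N\<close>.\<close>

lemma rows_single:
  assumes "i < x" "i + h * x < N" "N \<le> i + Suc h * x"
  shows "rows x N {i} = column x i 0 h"
proof (intro equalityI subsetI)
  fix n assume "n \<in> rows x N {i}"
  then have n: "n < N" "n mod x = i" by (auto simp: rows_def)
  have e: "n = i + (n div x) * x" using n(2) by (metis add.commute div_mult_mod_eq)
  then have "i + (n div x) * x < i + Suc h * x" using n(1) assms(3) by linarith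
  then have "n div x \<le> h" by (metis add_less_cancel_left less_Suc_eq_le mult_less_cancel2)
  then show "n \<in> column x i 0 h" using e by (auto simp: column_def)
next
  fix n assume "n \<in> column x i 0 h"
  then obtain j where j: "j \<le> h" "n = i + j * x" by (auto simp: column_def)
  have "j * x \<le> h * x" using j(1) by simp
  then have "n < N" using j(2) assms(2) by linarith
  then show "n \<in> rows x N {i}" using j(2) assms(1) by (simp add: rows_def)
qed

text \<open>Climb column \<open>i\<close>, cross by one unit step at the top, descend column
  \<open>i + 1\<close>. The bounds on \<open>N\<close> give both columns the same top index
  \<open>h\<close>.\<close>

lemma has_path_column_pair:
  assumes "i + 1 < x" "i + 1 + h * x < N" "N \<le> i + Suc h * x"
  shows "has_path x (rows x N {i, i + 1}) i (i + 1) 1"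
proof -
  have "rows x N {i, i + 1} = column x i 0 h \<union> column x (i + 1) 0 h"
    using rows_Un[of x N "{i}" "{i + 1}"] insert_is_Un[of i "{i + 1}"] rows_single[of i x h N] rows_single[of "i + 1" x h N] assms
    by simp
  then show ?thesis
    using has_path_join_1[OF has_path_column[of i x 0 h] has_path_rev[OF has_path_column[of "i + 1" x 0 h]]]
      column_disjoint[of i x "i + 1" h 0 h 0] assms by simp
qed

text \<open>As r is even, the classes 2j and 2j + 1 modulo x have equally many elements below N, so that
  the far ends of these two columns are adjacent.\<close>

lemma has_path_prepend_pairs:
  assumes "N = q * x + r" "even r" "r < x" "1 \<le> q" "2 * k \<le> x" "j \<le> k"
    and "has_path x T (2 * k) w a" "T \<inter> rows x N {2 * j..<2 * k} = {}"
  shows "has_path x (rows x N {2 * j..<2 * k} \<union> T) (2 * j) w (a + 2 * (k - j))"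
  using assms(6,8)
proof (induction j rule: inc_induct)
  case base
  then show ?case using assms(7) by (simp add: rows_def)
next
  case (step j)
  let ?i = "2 * j"
  have split: "{?i..<2 * k} = {?i, ?i + 1} \<union> {2 * Suc j..<2 * k}"
    using step.hyps by auto
  have IH: "has_path x (rows x N {2 * Suc j..<2 * k} \<union> T) (2 * Suc j) w (a + 2 * (k - Suc j))"
    using step.IH step.prems unfolding split rows_Un by blast
  have pair: "has_path x (rows x N {?i, ?i + 1}) ?i (?i + 1) 1"
  \<comment> \<open>The top index of a class is \<open>q\<close> for residues below \<open>r\<close>
    and \<open>q - 1\<close> for the others.\<close>
  proof (cases "?i < r")
    case True
    then have "?i + 1 < r" using assms(2) by presburger
    then show ?thesis using has_path_column_pair[of ?i x q N] assms(1,3) by simp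
  next
    case False
    obtain q' where "q = Suc q'" using assms(4) by (cases q) auto
    then show ?thesis using has_path_column_pair[of ?i x q' N] False assms(1,5) step.hyps by simp
  qed
  have "rows x N {?i, ?i + 1} \<inter> (rows x N {2 * Suc j..<2 * k} \<union> T) = {}"
    using step.prems unfolding split rows_Un by (auto simp: rows_def)
  from has_path_join_1[OF pair IH this] have
    "has_path x (rows x N {?i, ?i + 1} \<union> (rows x N {2 * Suc j..<2 * k} \<union> T)) ?i w
       (1 + (a + 2 * (k - Suc j)) + 1)" by simp
  \<comment> \<open>The two new unit steps are the crossing at the top of the pair and the step from
    \<open>2 * j + 1\<close> to \<open>2 * j + 2\<close>.\<close>
  moreover have "1 + (a + 2 * (k - Suc j)) + 1 = a + 2 * (k - j)" using step.hyps by simp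
  ultimately show ?case by (simp only: split rows_Un Un_assoc)
qed

text \<open>Each class is traversed completely before the next one is entered, so the
  \<open>x - 1\<close> changes of class are the only unit steps. Pairs of columns are prepended to
  the last two columns if \<open>x\<close> is even, to the last one if \<open>x\<close> is
  odd.\<close>

lemma has_path_snake:
  assumes "N = q * x + r" "even r" "r < x" "1 \<le> q" "2 \<le> x"
  shows "\<exists>w. has_path x {..<N} 0 w (x - 1)"
proof (cases "even x")
  case True
  define k where "k = x div 2 - 1"
  have x: "x = 2 * k + 2" using True assms(5) by (auto simp: k_def)
  \<comment> \<open>By parity \<open>r\<close> is not \<open>x - 1\<close>, so the last two columns
    both have top index \<open>q - 1\<close>.\<close>
  have "r \<le> 2 * k" using assms(2,3) x by presburger
  obtain q' where q': "q = Suc q'" using assms(4) by (cases q) auto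
  have "has_path x (rows x N {2 * k, 2 * k + 1}) (2 * k) (2 * k + 1) 1"
    using has_path_column_pair[of "2 * k" x q' N] q' assms(1) x \<open>r \<le> 2 * k\<close> by simp
  then have "has_path x (rows x N {2 * 0..<2 * k} \<union> rows x N {2 * k, 2 * k + 1}) (2 * 0) (2 * k + 1) (1 + 2 * (k - 0))"
    by (intro has_path_prepend_pairs[OF assms(1-4)]) (auto simp: x rows_def)
  moreover have "{2 * 0..<2 * k} \<union> {2 * k, 2 * k + 1} = {..<x}" using x by auto
  ultimately show ?thesis using rows_all[of x N] x by (auto simp: rows_Un[symmetric])
next
  case False
  define k where "k = x div 2"
  have x: "x = 2 * k + 1" using False by (auto simp: k_def)
  have r: "r \<le> 2 * k" using assms(3) x by simp
  obtain q' where q': "q = Suc q'" using assms(4) by (cases q) auto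
  have "has_path x (rows x N {2 * k}) (2 * k) (2 * k + q' * x) 0"
    using has_path_column[of "2 * k" x 0 q'] rows_single[of "2 * k" x q' N] q' assms(1) x r by simp
  then have "has_path x (rows x N {2 * 0..<2 * k} \<union> rows x N {2 * k}) (2 * 0) (2 * k + q' * x) (0 + 2 * (k - 0))"
    by (intro has_path_prepend_pairs[OF assms(1-4)]) (auto simp: x rows_def)
  moreover have "{2 * 0..<2 * k} \<union> {2 * k} = {..<x}" using x by auto
  ultimately show ?thesis using rows_all[of x N] x by (auto simp: rows_Un[symmetric])
qed

section \<open>Paths with x steps of length 1\<close>

lemma has_path_run:
  assumes "l \<le> h"
  shows "has_path x {l..h} l h (h - l)"
  using assms
proof (induction h rule: dec_induct)
  case base
  then show ?case by (simp add: has_path_single)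
next
  case (step h)
  then have "has_path x ({l..h} \<union> {Suc h}) l (Suc h) (h - l + 0 + 1)"
    by (intro has_path_join_1[OF step.IH has_path_single]) auto
  moreover have "{l..h} \<union> {Suc h} = {l..Suc h}" using step.hyps by auto
  ultimately show ?case using step.hyps by (simp add: Suc_diff_le)
qed

lemma has_path_shift:
  assumes "has_path x S u w a"
  shows "has_path x ((\<lambda>n. n + s) ` S) (u + s) (w + s) a"
proof -
  obtain p b where p: "distinct p" "set p = S" "p \<noteq> []" "hd p = u" "last p = w"
      "path_diffs p = replicate_mset a 1 + replicate_mset b x"
    using assms unfolding has_path_def by blast
  then show ?thesis unfolding has_path_def
    by (intro exI[of _ "map (\<lambda>n. n + s) p"] exI[of _ b])
       (simp add: path_diffs_shift distinct_map hd_map last_map)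
qed

lemma column_Un:
  assumes "l \<le> m" "m \<le> h"
  shows "column x i l h = column x i l m \<union> column x i (Suc m) h"
proof -
  have "{l..h} = {l..m} \<union> {Suc m..h}" using assms by auto
  then show ?thesis by (simp add: column_def image_Un)
qed

text \<open>The snake uses the edge length 1 only x - 1 times.  When the residue of N is even, the additional
  step of length 1 comes from visiting one column in two pieces: column 0 if x is even or N < 2x,
  and the last column but one otherwise.\<close>

lemma has_path_split_even:
  assumes "N = q * x + r" "even r" "r < x" "1 \<le> q" "2 \<le> x" "x < N" "even x"
  shows "\<exists>w. has_path x {..<N} 0 w x"
proof -
  \<comment> \<open>The common top index of columns 0 and 1. It is at least 1, so column 0 has
    elements besides 0.\<close>
  obtain h where h: "1 \<le> h" "1 + h * x < N" "N \<le> Suc h * x"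
  proof (cases "r = 0")
    case True
    have "q \<noteq> 1" using True assms(1,6) by auto
    define q' where "q' = q - 2"
    have "q = Suc (Suc q')" using \<open>q \<noteq> 1\<close> assms(4) by (simp add: q'_def)
    then show ?thesis using that[of "Suc q'"] True assms(1,5) by simp
  next
    case False
    then have "r \<ge> 2" using assms(2) by presburger
    then show ?thesis using that[of q] assms(1,3,4) by simp
  qed
  \<comment> \<open>Climb column 0 from \<open>x\<close>, cross, descend column 1 to 1; the vertex 0
    is then reached from 1 by the extra unit step.\<close>
  have "has_path x (column x 0 1 h \<union> column x 1 0 h) x 1 (0 + 0 + 1)"
    using has_path_join_1[OF has_path_column[of 0 x 1 h] has_path_rev[OF has_path_column[of 1 x 0 h]]]
      column_disjoint[of 0 x 1 h 0 h 1] assms(5) h(1) by simp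
  moreover have "column x 0 0 h = {0} \<union> column x 0 1 h"
    using column_Un[of 0 0 h x 0] by (simp add: column_single)
  moreover have "(column x 0 1 h \<union> column x 1 0 h) \<inter> {0} = {}"
    using column_disjoint[of 0 x 0 h 0 0 1] column_disjoint[of 1 x 0 h 0 0 0] assms(5)
    by (auto simp: column_single)
  moreover have "rows x N {0, 1} = column x 0 0 h \<union> column x 1 0 h"
    using rows_Un[of x N "{0}" "{1}"] rows_single[of 0 x h N] rows_single[of 1 x h N] assms(5) h
    by (simp add: insert_commute)
  ultimately have T: "has_path x (rows x N {0, 1}) x 0 2"
    using has_path_join_1[OF _ has_path_single, of x "column x 0 1 h \<union> column x 1 0 h" x 1 1 0]
    by (simp add: Un_ac numeral_2_eq_2)
  obtain k where k: "x = 2 * k" using assms(7) by auto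
  \<comment> \<open>The pairs 2, ..., \<open>x - 1\<close> end at \<open>x - 1\<close>, one unit
    step before the start \<open>x = 2 * k\<close> of the path just built. The result ends at 0 and
    is reversed afterwards.\<close>
  have "has_path x (rows x N {2 * 1..<2 * k} \<union> rows x N {0, 1}) (2 * 1) 0 (2 + 2 * (k - 1))"
    using assms(5) T k by (intro has_path_prepend_pairs[OF assms(1-4)]) (auto simp: rows_def)
  moreover have "{2 * 1..<2 * k} \<union> {0, 1} = {..<x}" using k assms(5) by auto
  moreover have "2 + 2 * (k - 1) = x" using k assms(5) by auto
  ultimately have "has_path x {..<N} 2 0 x"
    using rows_all[of x N] assms(5) by (simp add: rows_Un[symmetric])
  then show ?thesis by (meson has_path_rev)
qed

text \<open>Columns below \<open>r\<close> have two elements, the others one. Traverse the pairs 2,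
  ..., \<open>r - 1\<close>, then run through the consecutive integers from \<open>r\<close> to
  \<open>x + 1\<close>, jump by \<open>x\<close> down to 1 and finish at 0; the reversed path starts
  at 0.\<close>

lemma has_path_split_short:
  assumes "N = x + r" "even r" "0 < r" "r < x"
  shows "\<exists>w. has_path x {..<N} 0 w x"
proof -
  obtain k where k: "r = 2 * k" using assms(2) by auto
  let ?T = "{r..x + 1} \<union> {0..1}"
  have T: "has_path x ?T r 0 (x + 1 - r + 1)"
    using has_path_join_x[OF has_path_run[of r "x + 1" x] has_path_rev[OF has_path_run[of 0 1 x]]]
      assms k by auto
  have "has_path x (rows x N {2 * 1..<2 * k} \<union> ?T) (2 * 1) 0 (x + 1 - r + 1 + 2 * (k - 1))"
  proof (rule has_path_prepend_pairs[of N 1 x r])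
    show "?T \<inter> rows x N {2 * 1..<2 * k} = {}"
    proof -
      have "n mod x \<notin> {2..<r}" if "n \<in> ?T" for n
      proof (cases "n < x")
        case True
        then show ?thesis using that by auto
      next
        case False
        then have "n mod x = (n - x) mod x" by (simp add: le_mod_geq)
        also have "\<dots> = n - x" using that False assms k by auto
        finally show ?thesis using that by auto
      qed
      then show ?thesis using k by (auto simp: rows_def)
    qed
  qed (use assms k T in auto)
  moreover have "rows x N {2 * 1..<2 * k} \<union> ?T = {..<N}"
  proof -
    have "n \<in> rows x N {2..<r}" if "n < N" "n \<notin> ?T" for n
    proof (cases "n < x")
      case True
      then show ?thesis using that by (auto simp: rows_def)
    next
      case False
      then have "n mod x = (n - x) mod x" by (simp add: le_mod_geq)
      also have "\<dots> = n - x" using that False assms k by auto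
      finally show ?thesis using that assms False by (auto simp: rows_def)
    qed
    then show ?thesis using assms k by (auto simp: rows_def)
  qed
  moreover have "x + 1 - r + 1 + 2 * (k - 1) = x" using assms k by auto
  ultimately have "has_path x {..<N} 2 0 x" by simp
  then show ?thesis by (meson has_path_rev)
qed

text \<open>The pairs lead to the last three columns \<open>i\<close>, \<open>i + 1\<close>,
  \<open>i + 2\<close>, where \<open>i = x - 3\<close>. Climb column \<open>i\<close>, descend
  column \<open>i + 1\<close> only to the height of the top of column \<open>i + 2\<close>, descend
  the latter, and step back to climb the remaining bottom piece of column \<open>i + 1\<close>. This
  takes three unit steps instead of two.\<close>

lemma has_path_split_odd:
  assumes "N = q * x + r" "even r" "r < x" "2 \<le> q" "3 \<le> x" "odd x"
  shows "\<exists>w. has_path x {..<N} 0 w x"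
proof -
  define i where "i = x - 3"
  have x: "x = i + 3" using assms(5) by (simp add: i_def)
  have "even i" using assms(6) x by presburger
  then obtain k where k: "i = 2 * k" by auto
  define q' where "q' = q - 2"
  have q: "q = Suc (Suc q')" using assms(4) by (simp add: q'_def)
  \<comment> \<open>The common top index of columns \<open>i\<close> and \<open>i + 1\<close>, equal
    to \<open>q - 1\<close> or \<open>q\<close>. The last column always has top index
    \<open>q - 1 = Suc q'\<close>, which fixes the cut of column \<open>i + 1\<close>.\<close>
  obtain h where h: "Suc q' \<le> h" "i + 1 + h * x < N" "N \<le> i + Suc h * x"
  proof (cases "r \<le> i")
    case True
    then show ?thesis using that[of "Suc q'"] assms(1) q x by simp
  next
    case False
    then have "r = i + 2" using assms(2,3) \<open>even i\<close> x by presburger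
    then show ?thesis using that[of q] assms(1) q x by simp
  qed
  have last: "rows x N {i + 2} = column x (i + 2) 0 (Suc q')"
    using rows_single[of "i + 2" x "Suc q'" N] assms(1,3) q x by simp
  let ?A = "column x i 0 h" and ?B = "column x (i + 1) (Suc q') h"
    and ?C = "column x (i + 2) 0 (Suc q')" and ?D = "column x (i + 1) 0 q'"
  have "has_path x (?A \<union> ?B) i (i + 1 + Suc q' * x) (0 + 0 + 1)"
    using has_path_join_1[OF has_path_column[of i x 0 h]
        has_path_rev[OF has_path_column[of "i + 1" x "Suc q'" h]]]
      column_disjoint[of i x "i + 1" h "Suc q'" h 0] h(1) x by simp
  then have "has_path x ((?A \<union> ?B) \<union> ?C) i (i + 2) ((0 + 0 + 1) + 0 + 1)"
    using has_path_join_1[OF _ has_path_rev[OF has_path_column[of "i + 2" x 0 "Suc q'"]]]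
      column_disjoint[of i x "i + 2" h 0 "Suc q'" 0]
      column_disjoint[of "i + 1" x "i + 2" h 0 "Suc q'" "Suc q'"] x by (simp add: Int_Un_distrib2)
  then have "has_path x (((?A \<union> ?B) \<union> ?C) \<union> ?D) i (i + 1 + q' * x) (((0 + 0 + 1) + 0 + 1) + 0 + 1)"
    using has_path_join_1[OF _ has_path_column[of "i + 1" x 0 q']]
      column_disjoint[of i x "i + 1" h 0 q' 0]
      column_disjoint[of "i + 1" x "i + 1" h 0 q' "Suc q'"]
      column_disjoint[of "i + 2" x "i + 1" "Suc q'" 0 q' 0] x by (simp add: Int_Un_distrib2)
  moreover have "?A \<union> ?B \<union> ?C \<union> ?D = rows x N {i, i + 1, i + 2}"
  proof -
    have "rows x N {i, i + 1, i + 2} = rows x N {i} \<union> rows x N {i + 1} \<union> rows x N {i + 2}"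
      by (auto simp: rows_def)
    also have "rows x N {i} = ?A" using rows_single[of i x h N] x h by simp
    also have "rows x N {i + 1} = ?D \<union> ?B"
      using rows_single[of "i + 1" x h N] column_Un[of 0 q' h x "i + 1"] x h by simp
    also note last
    finally show ?thesis by blast
  qed
  ultimately have T: "has_path x (rows x N {i, i + 1, i + 2}) i (i + 1 + q' * x) 3"
    by (simp add: numeral_3_eq_3)
  have "has_path x (rows x N {2 * 0..<2 * k} \<union> rows x N {i, i + 1, i + 2}) (2 * 0) (i + 1 + q' * x)
      (3 + 2 * (k - 0))"
    using assms(4) T k x by (intro has_path_prepend_pairs[OF assms(1-3)]) (auto simp: rows_def)
  moreover have "{2 * 0..<2 * k} \<union> {i, i + 1, i + 2} = {..<x}" using k x by auto
  moreover have "3 + 2 * (k - 0) = x" using k x by auto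
  ultimately have "has_path x {..<N} 0 (i + 1 + q' * x) x"
    using rows_all[of x N] x by (simp add: rows_Un[symmetric] add.commute)
  then show ?thesis by blast
qed

text \<open>One of \<open>x + b\<close> and \<open>x + b + 1\<close> has even residue modulo
  \<open>x\<close>. In the first case a snake on 1, ..., \<open>x + b\<close> gains its missing unit
  step from the vertex 0 put in front; in the second a path with a split column covers all
  vertices.\<close>

lemma has_path_block:
  assumes "2 \<le> x"
  shows "\<exists>w. has_path x {..x + b} 0 w x"
proof (cases "even (b mod x)")
  case True
  have N: "x + b = (1 + b div x) * x + b mod x" by simp
  have "\<exists>w. has_path x {..<x + b} 0 w (x - 1)"
    by (rule has_path_snake[OF N True]) (use assms in auto)
  then obtain w where "has_path x {..<x + b} 0 w (x - 1)" by blast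
  then have "has_path x ((\<lambda>n. n + 1) ` {..<x + b}) 1 (w + 1) (x - 1)"
    using has_path_shift[of x "{..<x + b}" 0 w "x - 1" 1] by simp
  moreover have "(\<lambda>n. n + 1) ` {..<x + b} = {1..x + b}"
    using image_Suc_lessThan by simp
  ultimately have "has_path x ({0} \<union> {1..x + b}) 0 (w + 1) (0 + (x - 1) + 1)"
    by (intro has_path_join_1[OF has_path_single]) auto
  moreover have "{0} \<union> {1..x + b} = {..x + b}" by auto
  ultimately show ?thesis using assms by auto
next
  case False
  define N where "N = Suc (x + b)"
  define q r where "q = N div x" and "r = N mod x"
  have N: "N = q * x + r" by (simp add: q_def r_def)
  have r: "r < x" using assms by (simp add: r_def)
  have q: "1 \<le> q" using assms by (simp add: q_def N_def div_greater_zero_iff Suc_le_eq)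
  have "N = Suc b + x" by (simp add: N_def)
  then have "r = Suc (b mod x) mod x" unfolding r_def by (simp add: mod_Suc_eq del: add_Suc)
  \<comment> \<open>Either \<open>r\<close> is \<open>b mod x + 1\<close>, or
    \<open>b mod x = x - 1\<close> and \<open>r\<close> wraps around to 0.\<close>
  then have "even r" using False by (auto simp: mod_Suc)
  have "\<exists>w. has_path x {..<N} 0 w x"
  proof (cases "even x")
    case True
    then show ?thesis using has_path_split_even[OF N \<open>even r\<close> r q] assms N_def by simp
  next
    case odd: False
    show ?thesis
    proof (cases "q = 1")
      case True
      then have "N = x + r" "0 < r" using N N_def by auto
      then show ?thesis using has_path_split_short \<open>even r\<close> r by blast
    next
      case False
      have "3 \<le> x" using odd assms by presburger
      then show ?thesis using has_path_split_odd[OF N \<open>even r\<close> r] odd q False by simp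
    qed
  qed
  then show ?thesis by (simp add: N_def lessThan_Suc_atMost)
qed

section \<open>Linear realizations\<close>

text \<open>Starting at 0 allows induction on \<open>a\<close>: shift the path by one and put a new
  0 in front, which costs one unit step. The base case is the path with exactly \<open>x\<close>
  unit steps.\<close>

lemma standard_realization:
  assumes "2 \<le> x" "x \<le> a"
  shows "\<exists>p. distinct p \<and> set p = {..a + b} \<and> p \<noteq> [] \<and> hd p = 0 \<and>
             path_diffs p = replicate_mset a 1 + replicate_mset b x"
  using assms(2)
proof (induction a rule: dec_induct)
  case base
  obtain p c where p: "distinct p" "set p = {..x + b}" "p \<noteq> []" "hd p = 0"
      "path_diffs p = replicate_mset x 1 + replicate_mset c x"
    using has_path_block[OF assms(1), of b] unfolding has_path_def by blast
  \<comment> \<open>Counting vertices identifies the existential number of steps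
    \<open>x\<close>.\<close>
  have "x + c = length p - 1" using size_diffs[OF p(3)] p(5) by simp
  also have "length p = Suc (x + b)" using distinct_card[OF p(1)] p(2) by simp
  finally have "c = b" by simp
  then show ?case using p by blast
next
  case (step a)
  then obtain p where p: "distinct p" "set p = {..a + b}" "p \<noteq> []" "hd p = 0"
      "path_diffs p = replicate_mset a 1 + replicate_mset b x" by blast
  let ?q = "map (\<lambda>n. n + 1) p"
  have "hd ?q = 1" using p by (simp add: hd_map)
  then obtain q where q: "?q = 1 # q" using p(3) by (cases ?q) auto
  have "path_diffs (0 # ?q) = replicate_mset (Suc a) 1 + replicate_mset b x"
    using path_diffs_shift[of 1 p] p(5) unfolding q by simp
  moreover have "set (0 # ?q) = {..Suc a + b}"
    using p(2) by (simp add: atMost_Suc_eq_insert_0)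
  moreover have "distinct (0 # ?q)" using p(1) by (simp add: distinct_map)
  ultimately show ?case by (intro exI[of _ "0 # ?q"]) simp
qed

text \<open>Of the unit steps, \<open>y\<close> go to a path with steps \<open>y\<close> on 0, ...,
  \<open>y + c\<close>, reflected so as to end at its maximum. The remaining \<open>a - y\<close>
  are at least \<open>x\<close> and suffice for a path with steps \<open>x\<close>, translated to
  start at that maximum.\<close>

lemma linear_realization:
  assumes "2 \<le> x" "2 \<le> y" "x + y \<le> a"
  shows "\<exists>p. distinct p \<and> set p = {..a + b + c} \<and>
             path_diffs p = replicate_mset a 1 + replicate_mset b x + replicate_mset c y"
proof -
  define a' where "a' = a - y"
  have a: "a = y + a'" "x \<le> a'" using assms(3) by (auto simp: a'_def)
  let ?s = "y + c"
  obtain p where p: "distinct p" "set p = {..?s}" "p \<noteq> []" "hd p = 0"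
      "path_diffs p = replicate_mset y 1 + replicate_mset c y"
    using standard_realization[of y y c] assms by blast
  obtain q where q: "distinct q" "set q = {..a' + b}" "q \<noteq> []" "hd q = 0"
      "path_diffs q = replicate_mset a' 1 + replicate_mset b x"
    using standard_realization[of x a' b] assms a by blast
  define p' where "p' = rev (map (\<lambda>n. ?s - n) p)"
  \<comment> \<open>The start of \<open>q\<close> is removed, since after translation it coincides
    with the last vertex of \<open>p'\<close>.\<close>
  obtain q' where q': "q = 0 # q'" using q(3,4) by (cases q) auto
  have set_q': "set q' = {1..a' + b}"
  proof -
    have "0 \<notin> set q'" using q(1) q' by simp
    moreover have "insert 0 (set q') = {..a' + b}" using q(2) q' by simp
    ultimately have "set q' = {..a' + b} - {0}" by blast
    also have "\<dots> = {1..a' + b}" by (auto simp: Suc_le_eq)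
    finally show ?thesis .
  qed
  have set_p': "set p' = {..?s}"
  proof -
    have "{..?s} \<subseteq> (\<lambda>n. ?s - n) ` {..?s}"
    proof
      fix n assume "n \<in> {..?s}"
      then show "n \<in> (\<lambda>n. ?s - n) ` {..?s}" by (intro image_eqI[of _ _ "?s - n"]) auto
    qed
    moreover have "(\<lambda>n. ?s - n) ` {..?s} \<subseteq> {..?s}" by (rule image_subsetI) simp
    ultimately show ?thesis unfolding p'_def set_rev set_map p(2) by (rule antisym[rotated])
  qed
  have last_p': "last p' = ?s" "p' \<noteq> []"
    using p(3,4) by (auto simp: p'_def last_rev hd_map)
  let ?q = "map (\<lambda>n. n + ?s) q'"
  have "path_diffs (p' @ ?q) = path_diffs p' + path_diffs (map (\<lambda>n. n + ?s) q)"
    using path_diffs_append_last[OF last_p'(2), of ?q] last_p'(1) q' by simp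
  also have "path_diffs (map (\<lambda>n. n + ?s) q) = path_diffs q" by (rule path_diffs_shift)
  also have "path_diffs p' = path_diffs p"
    unfolding p'_def path_diffs_rev by (rule path_diffs_reflect) (use p(2) in simp)
  finally have "path_diffs (p' @ ?q) = replicate_mset a 1 + replicate_mset b x + replicate_mset c y"
    by (simp add: p q a multiset_eq_iff)
  moreover have "set (p' @ ?q) = {..a + b + c}"
  proof -
    have "a + b + c = a' + b + ?s" using a by simp
    then have "{..a + b + c} = {..?s} \<union> {Suc ?s..a' + b + ?s}" by auto
    moreover have "{Suc ?s..a' + b + ?s} = (\<lambda>n. n + ?s) ` {1..a' + b}"
      by (simp only: image_add_atLeastAtMost' plus_1_eq_Suc)
    ultimately show ?thesis by (simp only: set_append set_map set_p' set_q')
  qed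
  moreover have "distinct (p' @ ?q)"
  proof -
    have "inj_on (\<lambda>n. ?s - n) {..?s}" by (auto intro!: inj_onI)
    then show ?thesis using p(1,2) q(1) q' unfolding distinct_append set_p'
      by (auto simp: p'_def distinct_map set_q')
  qed
  ultimately show ?thesis by blast
qed

section \<open>Multiplication by a unit modulo v\<close>

text \<open>The minimum is the distance from \<open>D\<close> to the nearest multiple of
  \<open>v\<close>. The size bounds leave only \<open>f\<close> and \<open>f - v\<close> as values
  of \<open>D\<close> or \<open>- D\<close>.\<close>

lemma min_residue:
  fixes D f v :: int
  assumes "\<bar>D\<bar> < v" "0 \<le> f" "2 * f \<le> v" "[D = f] (mod v) \<or> [D = - f] (mod v)"
  shows "min \<bar>D\<bar> (v - \<bar>D\<bar>) = f"
proof -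
  have *: "E = f \<or> E = f - v" if E: "\<bar>E\<bar> < v" "[E = f] (mod v)" for E
  proof -
    obtain k where k: "E = f + v * k" using E(2) by (metis cong_iff_lin cong_sym)
    have "0 < v" using assms(1) by linarith
    moreover have "v * k < v * 1" "v * (- 2) < v * k" using E(1) assms(2,3) k by linarith+
    ultimately have "k < 1" "- 2 < k" using mult_less_cancel_left_pos by blast+
    then have "k = 0 \<or> k = - 1" by linarith
    then show ?thesis using k by auto
  qed
  have "[- D = f] (mod v)" if "[D = - f] (mod v)"
    using that by (metis add.inverse_inverse cong_minus_minus_iff)
  then have "D = f \<or> D = f - v \<or> - D = f \<or> - D = f - v"
    using *[of D] *[of "- D"] assms(1,4) by auto
  then show ?thesis using assms(2,3) by auto
qed

lemma successively_complete_graph: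
  assumes "distinct p" "set p \<subseteq> {..<v}"
  shows "successively (\<lambda>u w. {u, w} \<in> complete_graph_edges v) p"
  using assms by (induction p rule: path_diffs.induct) (auto simp: complete_graph_edges_def)

lemma path_edge_lengths_map:
  assumes "\<And>u w. nat \<bar>int u - int w\<bar> \<in># path_diffs p \<Longrightarrow> edge_length v (g u) (g w) = f (nat \<bar>int u - int w\<bar>)"
  shows "path_edge_lengths v (map g p) = image_mset f (path_diffs p)"
  using assms by (induction p rule: path_diffs.induct) (auto simp: path_edge_lengths_def)

text \<open>Multiplication by the unit \<open>m\<close> permutes the residues modulo
  \<open>v\<close> and multiplies all differences by \<open>m\<close>. So a step \<open>d\<close>
  becomes an edge whose length is the representative of \<open>d * m\<close> up to sign that is at
  most \<open>v div 2\<close>, namely \<open>f d\<close>.\<close>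

lemma realizable_scale:
  assumes "distinct p" "set p = {..<v}" "0 < v" "coprime m v"
    and f: "\<And>d. d \<in># path_diffs p \<Longrightarrow> f d \<le> v div 2 \<and>
      ([int (d * m) = int (f d)] (mod int v) \<or> [int (d * m) = - int (f d)] (mod int v))"
  shows "realizable v (image_mset f (path_diffs p))"
proof -
  define g where "g n = n * m mod v" for n
  have "inj_on g {..<v}"
  proof (rule inj_onI)
    fix n n' assume *: "n \<in> {..<v}" "n' \<in> {..<v}" "g n = g n'"
    then have "[n * m = n' * m] (mod v)" by (simp add: g_def cong_def)
    then have "[n = n'] (mod v)" using assms(4) by (simp add: cong_mult_rcancel_nat)
    then show "n = n'" using * by (simp add: cong_def)
  qed
  moreover have "g ` {..<v} \<subseteq> {..<v}" using assms(3) by (auto simp: g_def)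
  ultimately have bij: "g ` {..<v} = {..<v}" by (simp add: endo_inj_surj)
  have path: "hamiltonian_path {0..<v} (complete_graph_edges v) (map g p)"
    unfolding hamiltonian_path_def
    using assms(1,2) \<open>inj_on g {..<v}\<close> bij successively_complete_graph[of "map g p" v]
    by (auto simp: distinct_map atLeast0LessThan)
  have "edge_length v (g u) (g w) = f (nat \<bar>int u - int w\<bar>)"
    if d: "nat \<bar>int u - int w\<bar> \<in># path_diffs p" for u w
  proof -
    let ?d = "nat \<bar>int u - int w\<bar>"
    let ?D = "int (g u) - int (g w)"
    have "[?D = int (u * m) - int (w * m)] (mod int v)"
      unfolding g_def by (intro cong_diff) (simp_all add: cong_def zmod_int)
    \<comment> \<open>Passing to the absolute difference loses the sign, which the edge length does
      not see.\<close>
    moreover have "int (u * m) - int (w * m) = int (?d * m) \<or> int (u * m) - int (w * m) = - int (?d * m)"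
      by (auto simp: abs_if algebra_simps)
    ultimately consider "[?D = int (?d * m)] (mod int v)" | "[- ?D = int (?d * m)] (mod int v)"
      by (metis add.inverse_inverse cong_minus_minus_iff)
    then have "[?D = int (f ?d)] (mod int v) \<or> [?D = - int (f ?d)] (mod int v)"
    proof cases
      case 1
      then show ?thesis using f[OF d] cong_trans by blast
    next
      case 2
      then have "[- ?D = int (f ?d)] (mod int v) \<or> [- ?D = - int (f ?d)] (mod int v)"
        using f[OF d] cong_trans by blast
      then show ?thesis by (metis add.inverse_inverse cong_minus_minus_iff)
    qed
    moreover have "g u < v" "g w < v" using assms(3) by (auto simp: g_def)
    then have "\<bar>?D\<bar> < int v" by linarith
    moreover have "2 * int (f ?d) \<le> int v" using f[OF d] by linarith
    ultimately have "min \<bar>?D\<bar> (int v - \<bar>?D\<bar>) = int (f ?d)"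
      by (intro min_residue) auto
    then show ?thesis by (simp add: edge_length_def)
  qed
  then have "path_edge_lengths v (map g p) = image_mset f (path_diffs p)"
    by (rule path_edge_lengths_map)
  then show ?thesis using path unfolding realizable_def by blast
qed

text \<open>Scales a linear realization with steps 1, \<open>y\<close>, \<open>z\<close> by
  \<open>m\<close>; \<open>i\<close>, \<open>j\<close>, \<open>l\<close> are the resulting lengths.
  The length \<open>i\<close> that comes from unit steps is the one whose multiplicity must be
  large.\<close>

lemma realizable_replicate:
  assumes "2 \<le> y" "y < z" "y + z \<le> a" "v = a + b + c + 1" "coprime m v"
    and "i \<le> v div 2" "[int m = int i] (mod int v) \<or> [int m = - int i] (mod int v)"
    and "j \<le> v div 2" "[int (y * m) = int j] (mod int v) \<or> [int (y * m) = - int j] (mod int v)"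
    and "l \<le> v div 2" "[int (z * m) = int l] (mod int v) \<or> [int (z * m) = - int l] (mod int v)"
  shows "realizable v (replicate_mset a i + replicate_mset b j + replicate_mset c l)"
proof -
  obtain p where p: "distinct p" "set p = {..a + b + c}"
      "path_diffs p = replicate_mset a 1 + replicate_mset b y + replicate_mset c z"
    using linear_realization[of y z a b c] assms(1-3) by auto
  define f where "f d = (if d = 1 then i else if d = y then j else l)" for d
  have "realizable v (image_mset f (path_diffs p))"
  proof (rule realizable_scale[OF p(1) _ _ assms(5)])
    show "set p = {..<v}" using p(2) assms(4) by (simp add: lessThan_Suc_atMost)
    fix d assume "d \<in># path_diffs p"
    then have "d = 1 \<or> d = y \<or> d = z" by (auto simp: p(3) split: if_splits)
    then show "f d \<le> v div 2 \<and> ([int (d * m) = int (f d)] (mod int v) \<or> [int (d * m) = - int (f d)] (mod int v))"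
      using assms(1,2,6-) by (auto simp: f_def)
  qed (simp add: assms(4))
  moreover have "image_mset f (path_diffs p) = replicate_mset a i + replicate_mset b j + replicate_mset c l"
    using assms(1,2) by (simp add: p(3) f_def)
  ultimately show ?thesis by simp
qed

section \<open>The lengths 1, x and tx\<close>

lemma realizable_if_large_multiplicity:
  assumes "3 \<le> x" "2 \<le> t" "2 \<le> k" "v = t * x * k + 1 \<or> v + 1 = t * x * k" "t * x \<le> v div 2"
    and "v = a + b + c + 1" "x + t * x \<le> a \<or> t + t * k \<le> b \<or> k + k * x \<le> c"
  shows "realizable v (replicate_mset a 1 + replicate_mset b x + replicate_mset c (t * x))"
proof -
  have "2 * x \<le> t * x" using assms(2) by simp
  then have le: "1 \<le> v div 2" "x \<le> v div 2" using assms(1,5) by linarith+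
  have inv: "[int (t * x * k) = 1] (mod int v) \<or> [int (t * x * k) = - 1] (mod int v)"
  proof -
    have "int (t * x * k) - (- 1) = int v \<or> int (t * x * k) - 1 = int v" using assms(4) by linarith
    then show ?thesis by (metis cong_iff_dvd_diff dvd_refl)
  qed
  \<comment> \<open>This is \<open>x\<close> times the congruence \<open>inv\<close>; it shows that
    scaling by \<open>t * x\<close> turns steps \<open>k * x\<close> into edges of length
    \<open>x\<close>.\<close>
  have inv_x: "[int (k * x * (t * x)) = int x] (mod int v) \<or> [int (k * x * (t * x)) = - int x] (mod int v)"
    using inv cong_scalar_left[of "int (t * x * k)" 1 "int v" "int x"]
      cong_scalar_left[of "int (t * x * k)" "- 1" "int v" "int x"] by (auto simp: ac_simps)
  have "coprime (t * x * k) v"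
    using assms(4)
  proof
    assume "v = t * x * k + 1"
    then show ?thesis using coprime_Suc_right_nat[of "t * x * k"] by (simp only: Suc_eq_plus1)
  next
    assume "v + 1 = t * x * k"
    then show ?thesis using coprime_Suc_left_nat[of v] by (simp only: Suc_eq_plus1)
  qed
  then have cop: "coprime x v" "coprime (t * x) v" by auto
  consider "x + t * x \<le> a" | "t + t * k \<le> b" | "k + k * x \<le> c" using assms(7) by blast
  then show ?thesis
  proof cases
    case 1
    then show ?thesis using assms le
      by (intro realizable_replicate[of x "t * x" a v b c 1]) auto
  next
    case 2
    have "realizable v (replicate_mset b x + replicate_mset c (t * x) + replicate_mset a 1)"
      using 2 assms le cop inv
      by (intro realizable_replicate[of t "t * k" b v c a x]) (auto simp: ac_simps)
    then show ?thesis by (simp add: ac_simps)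
  next
    case 3
    have "realizable v (replicate_mset c (t * x) + replicate_mset a 1 + replicate_mset b x)"
      using 3 assms le cop inv inv_x
      by (intro realizable_replicate[of k "k * x" c v a b "t * x"]) (auto simp: ac_simps)
    then show ?thesis by (simp add: ac_simps)
  qed
qed

lemma mset_eq_replicate_3:
  assumes "set_mset L \<subseteq> {x, y, z}" "x \<noteq> y" "x \<noteq> z" "y \<noteq> z"
  shows "L = replicate_mset (count L x) x + replicate_mset (count L y) y + replicate_mset (count L z) z"
proof (rule multiset_eqI)
  fix n
  have "n \<notin> {x, y, z} \<Longrightarrow> count L n = 0" using assms(1) by (meson not_in_iff subsetD)
  then show "count L n = count (replicate_mset (count L x) x + replicate_mset (count L y) y
      + replicate_mset (count L z) z) n"
    using assms(2-4) by auto
qed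

text \<open>The hypothesis \<open>large\<close> is the lower bound on \<open>v\<close> with its
  denominator cleared and no subtraction. As \<open>t * x * k\<close> is at most
  \<open>v + 1\<close>, it makes the sum of the three thresholds smaller than \<open>v\<close>, so
  the multiplicities cannot all fall short.\<close>

lemma realizable_if_large:
  assumes "3 \<le> x" "2 \<le> t" "0 < v"
    and cong: "[int v = 1] (mod int (t * x)) \<or> [int v = - 1] (mod int (t * x))"
    and large: "t * x * (t * x + t + x) + (v + 1) * (t + x + 1) < t * x * v"
    and L: "edge_length_multiset v L" "set_mset L = {1, x, t * x}"
  shows "realizable v L"
proof -
  have "2 * 3 \<le> t * x" using assms(1,2) by (intro mult_le_mono)
  have le: "t * x \<le> v div 2" using L by (auto simp: edge_length_multiset_def)
  obtain k where k: "v = t * x * k + 1 \<or> v + 1 = t * x * k"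
  proof -
    have "t * x dvd v - 1 \<or> t * x dvd v + 1"
    proof -
      have "int (t * x) dvd int (v - 1) \<or> int (t * x) dvd int (v + 1)"
        using cong assms(3) by (auto simp: cong_iff_dvd_diff of_nat_diff ac_simps)
      then show ?thesis by (metis int_dvd_int_iff)
    qed
    then obtain k where "v - 1 = t * x * k \<or> v + 1 = t * x * k" by (auto elim!: dvdE)
    then show ?thesis using that[of k] assms(3) by linarith
  qed
  \<comment> \<open>An edge of length \<open>t * x\<close> forces \<open>v\<close> to be at least
    \<open>2 * (t * x)\<close>, which exceeds \<open>t * x + 1\<close>.\<close>
  have "2 \<le> k"
  proof (rule ccontr)
    assume "\<not> 2 \<le> k"
    then have "k = 0 \<or> k = 1" by linarith
    then show False using k le \<open>2 * 3 \<le> t * x\<close> by auto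
  qed
  define a b c where "a = count L 1" and "b = count L x" and "c = count L (t * x)"
  have Leq: "L = replicate_mset a 1 + replicate_mset b x + replicate_mset c (t * x)"
    unfolding a_def b_def c_def
    by (rule mset_eq_replicate_3) (use L assms(1,2) in auto)
  have "size L = a + b + c" by (subst Leq) simp
  then have v: "v = a + b + c + 1" using L(1) assms(3) by (simp add: edge_length_multiset_def)
  have "t * x * k \<le> v + 1" using k by linarith
  then have "t * x * k * (t + x + 1) \<le> (v + 1) * (t + x + 1)" by (rule mult_le_mono1)
  then have "t * x * (t * x + t + x + k * (t + x + 1)) < t * x * v"
    using large by (simp add: algebra_simps)
  then have "t * x + t + x + k * (t + x + 1) < v" by simp
  \<comment> \<open>If all three failed, \<open>v - 1 = a + b + c\<close> would be at most the sum
    of the thresholds minus 3.\<close>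
  then have "x + t * x \<le> a \<or> t + t * k \<le> b \<or> k + k * x \<le> c"
    unfolding v by (simp add: algebra_simps) linarith
  then show ?thesis
    using realizable_if_large_multiplicity[OF assms(1,2) \<open>2 \<le> k\<close> k le v] Leq by simp
qed

theorem theorem4p7:
  fixes t x v :: nat
  assumes "x \<ge> 3" and "t \<ge> 2" and "(t, x) \<noteq> (2, 3)" and "v > 0"
    and "[int v = 1] (mod int (t * x)) \<or> [int v = - 1] (mod int (t * x))"
  shows "(real v > (real t ^ 2 * real x ^ 2 + real t ^ 2 * real x + real t * real x ^ 2
              + real t + real x + 1) / (real t * real x - real t - real x - 1)
            \<longrightarrow> (\<forall>L. edge_length_multiset v L \<and> set_mset L = {1, x, t * x} \<longrightarrow> realizable v L))
       \<and> (t \<ge> 7 \<and> x \<ge> 7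
            \<longrightarrow> (\<forall>L. edge_length_multiset v L \<and> set_mset L = {1, x, t * x} \<longrightarrow> realizable v L))"
proof (intro conjI impI allI)
  fix L
  assume bound: "real v > (real t ^ 2 * real x ^ 2 + real t ^ 2 * real x + real t * real x ^ 2
              + real t + real x + 1) / (real t * real x - real t - real x - 1)"
    and L: "edge_length_multiset v L \<and> set_mset L = {1, x, t * x}"
  \<comment> \<open>In terms of the excesses \<open>t'\<close> and \<open>x'\<close> over 2 and 3
    the denominator is a sum of nonnegative terms that vanishes only at the excluded pair.\<close>
  have "0 < real t * real x - real t - real x - 1"
  proof -
    obtain t' x' where e: "t = t' + 2" "x = x' + 3"
      using assms(1,2) by (metis le_iff_add add.commute)
    then have "0 < t' \<or> 0 < x'" using assms(3) by auto
    then have "0 < t' * x' + 2 * t' + x'" by auto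
    then have "0 < real (t' * x' + 2 * t' + x')" by (simp only: of_nat_0_less_iff)
    also have "\<dots> = real t * real x - real t - real x - 1" by (simp add: e algebra_simps)
    finally show ?thesis .
  qed
  then have "real t ^ 2 * real x ^ 2 + real t ^ 2 * real x + real t * real x ^ 2 + real t + real x + 1
      < real v * (real t * real x - real t - real x - 1)"
    using bound by (simp add: pos_divide_less_eq)
  then have "real (t * x * (t * x + t + x) + (v + 1) * (t + x + 1)) < real (t * x * v)"
    by (simp add: algebra_simps power2_eq_square)
  then have "t * x * (t * x + t + x) + (v + 1) * (t + x + 1) < t * x * v"
    by (simp only: of_nat_less_iff)
  then show "realizable v L"
    using realizable_if_large[OF assms(1,2,4,5)] L by blast
next
  fix L
  assume "7 \<le> t \<and> 7 \<le> x" and L: "edge_length_multiset v L \<and> set_mset L = {1, x, t * x}"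
  then obtain t' x' where e: "t = t' + 7" "x = x' + 7"
    by (metis le_iff_add add.commute)
  \<comment> \<open>Containing the edge length \<open>t * x\<close> already bounds \<open>v\<close>
    below by \<open>2 * (t * x)\<close>. It is enough to check the inequality there, since raising
    \<open>v\<close> by \<open>w\<close> adds \<open>w * (t + x + 1)\<close> on the left and the
    larger \<open>w * (t * x)\<close> on the right.\<close>
  have "t * x \<in> {1..v div 2}" using L by (auto simp: edge_length_multiset_def)
  then have "2 * (t * x) \<le> v" by auto
  then obtain w where v: "v = 2 * (t * x) + w" by (metis le_iff_add)
  have "t + x + 1 \<le> t * x" by (simp add: e algebra_simps)
  then have "w * (t + x + 1) \<le> w * (t * x)" by (rule mult_le_mono2)
  moreover have "t * x * (t * x + t + x) + (2 * (t * x) + 1) * (t + x + 1) < t * x * (2 * (t * x))"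
  proof -
    \<comment> \<open>At \<open>v = 2 * (t * x)\<close> the left side is
      \<open>t * x * (t * x + 3 * (t + x) + 2)\<close> plus \<open>t + x + 1\<close>, and this last
      term is less than one further \<open>t * x\<close>.\<close>
    have "3 * (t + x) + 3 \<le> t * x" by (simp add: e algebra_simps)
    then have "t * x * (3 * (t + x) + 3) \<le> t * x * (t * x)" by (rule mult_le_mono2)
    moreover have "t + x + 1 < t * x" by (simp add: e algebra_simps)
    ultimately show ?thesis by (simp add: algebra_simps)
  qed
  ultimately have "t * x * (t * x + t + x) + (v + 1) * (t + x + 1) < t * x * v"
    by (simp add: v algebra_simps)
  then show "realizable v L"
    using realizable_if_large[OF assms(1,2,4,5)] L by blast
qed

end
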